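(* Let $\mathcal{P}=(P,\leq)$ be a finite bounded poset with least element $\hat0$. The $m$-cover poset $\mathcal{P}^{\langle m\rangle}$ is a lattice for all integers $m>0$ if and only if $\mathcal{P}$ is a lattice and for all $p,q\in P$ we have $p\wedge q\in\{\hat{0},p,q\}$.
   Context: The $m$-cover poset $\mathcal{P}^{\langle m\rangle}$ is the subposet of the componentwise-ordered direct product $\mathcal{P}^m$ consisting of the multichains $x_1\le\cdots\le x_m$ of $\mathcal P$ such that $\{x_1,\dots,x_m\}\setminus\{\hat0\}$ is empty, a single element, or a two-element set $\{p,q\}$ with $p\lessdot q$ (a covering relation in $\mathcal P$). *)

theory Defs
  imports "HOL-Algebra.Lattice"
begin

definition covered_by :: "('a, 'b) gorder_scheme \<Rightarrow> 'a \<Rightarrow> 'a \<Rightarrow> bool"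
  where "covered_by P p q \<longleftrightarrow>
    p \<in> carrier P \<and> q \<in> carrier P \<and> p \<sqsubset>\<^bsub>P\<^esub> q \<and>
    \<not> (\<exists>z \<in> carrier P. p \<sqsubset>\<^bsub>P\<^esub> z \<and> z \<sqsubset>\<^bsub>P\<^esub> q)"

text \<open>Elements of the direct power are represented as lists of length \<open>m\<close>.\<close>

definition power_poset :: "nat \<Rightarrow> ('a, 'b) gorder_scheme \<Rightarrow> 'a list gorder"
  where "power_poset m P =
    \<lparr> carrier = {xs. length xs = m \<and> set xs \<subseteq> carrier P},
      eq = (=),
      le = list_all2 (le P) \<rparr>"

definition m_cover_poset :: "nat \<Rightarrow> ('a, 'b) gorder_scheme \<Rightarrow> 'a list gorder"
  where "m_cover_poset m P = (power_poset m P)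
    \<lparr> carrier := {xs \<in> carrier (power_poset m P).
        sorted_wrt (le P) xs \<and>
        (set xs - {\<bottom>\<^bsub>P\<^esub>} = {} \<or>
         (\<exists>p. set xs - {\<bottom>\<^bsub>P\<^esub>} = {p}) \<or>
         (\<exists>p q. set xs - {\<bottom>\<^bsub>P\<^esub>} = {p, q} \<and> covered_by P p q))} \<rparr>"

end

theory Submission
  imports Defs
begin

text \<open>The condition on meets says that any two elements with a common lower bound other than
  \<open>\<bottom>\<close> are comparable. If it holds, \<open>m\<close>-cover posets are closed under componentwise meets,
  and a finite meet semilattice with a top is a lattice. If it fails at \<open>p\<close> and \<open>q\<close>, one may
  replace both by covers of \<open>z = p \<sqinter> q \<noteq> \<bottom>\<close>; then \<open>(z, p)\<close> and \<open>(z, q)\<close> have no join in the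
  \<open>2\<close>-cover poset: with \<open>r = p \<squnion> q\<close>, such a join would lie below every \<open>(c, r)\<close> where \<open>c\<close> is a
  lower cover of \<open>r\<close> above \<open>z\<close>, and there are two different ones, above \<open>p\<close> and above \<open>q\<close>.\<close>

section \<open>Covers and joins in finite posets\<close>

lemma (in partial_order) covered_by_dual:
  "covered_by (inv_gorder L) p q \<longleftrightarrow> covered_by L q p"
proof -
  interpret dual: partial_order "inv_gorder L"
    by (rule dual_order)
  show ?thesis
    unfolding covered_by_def by (simp add: lless_eq dual.lless_eq) blast
qed

text \<open>Descend from \<open>y\<close>: an element \<open>z\<close> strictly between
  \<open>x\<close> and \<open>y\<close> has fewer elements strictly below it than \<open>y\<close>
  has, and a cover of \<open>x\<close> below \<open>z\<close> is also below
  \<open>y\<close>.\<close>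

lemma (in partial_order) exists_upper_cover:
  assumes "finite (carrier L)" "x \<in> carrier L" "y \<in> carrier L" "x \<sqsubset> y"
  shows "\<exists>c. covered_by L x c \<and> c \<sqsubseteq> y"
  using assms(3,4)
proof (induction "card {w \<in> carrier L. w \<sqsubset> y}" arbitrary: y rule: less_induct)
  case less
  show ?case
  proof (cases "covered_by L x y")
    case True
    then show ?thesis using less.prems by auto
  next
    case False
    then obtain z where z: "z \<in> carrier L" "x \<sqsubset> z" "z \<sqsubset> y"
      using less.prems assms(2) by (auto simp: covered_by_def)
    have "{w \<in> carrier L. w \<sqsubset> z} \<subset> {w \<in> carrier L. w \<sqsubset> y}"
      using z less.prems lless_trans[of _ z y] by (auto simp: lless_eq)
    then have "card {w \<in> carrier L. w \<sqsubset> z} < card {w \<in> carrier L. w \<sqsubset> y}"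
      using assms(1) by (simp add: psubset_card_mono)
    from less.hyps[OF this z(1,2)] obtain c where c: "covered_by L x c" "c \<sqsubseteq> z"
      by blast
    moreover have "c \<in> carrier L"
      using c(1) by (simp add: covered_by_def)
    ultimately show ?thesis
      using z less.prems le_trans[of c z y] by (auto simp: lless_eq)
  qed
qed

lemma (in partial_order) exists_lower_cover:
  assumes "finite (carrier L)" "x \<in> carrier L" "y \<in> carrier L" "x \<sqsubset> y"
  shows "\<exists>c. covered_by L c y \<and> x \<sqsubseteq> c"
proof -
  interpret dual: partial_order "inv_gorder L"
    by (rule dual_order)
  show ?thesis
    using dual.exists_upper_cover[of y x] assms
    by (auto simp: covered_by_dual lless_eq dual.lless_eq)
qed

text \<open>The join of \<open>x\<close> and \<open>y\<close> is the meet of all their common upper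
  bounds. These form a finite set, and \<open>t\<close> makes it non-empty.\<close>

lemma (in lower_semilattice) finite_lattice_if_top:
  assumes "finite (carrier L)" "t \<in> carrier L" "\<And>x. x \<in> carrier L \<Longrightarrow> x \<sqsubseteq> t"
  shows "lattice L"
proof unfold_locales
  fix x y assume xy: "x \<in> carrier L" "y \<in> carrier L"
  let ?U = "Upper L {x, y}"
  have "t \<in> ?U"
    using assms xy by (auto simp: Upper_def)
  moreover have "finite ?U"
    using assms(1) by (rule finite_subset[OF Upper_closed])
  ultimately have g: "greatest L (\<Sqinter>?U) (Lower L ?U)"
    by (intro finite_inf_greatest) auto
  have "least L (\<Sqinter>?U) ?U"
  proof (rule least_UpperI)
    fix u assume "u \<in> {x, y}"
    then have "u \<in> Lower L ?U"
      using xy by (auto simp: Upper_def Lower_def)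
    then show "u \<sqsubseteq> \<Sqinter>?U"
      by (rule greatest_le[OF g])
  next
    fix u assume "u \<in> ?U"
    then show "\<Sqinter>?U \<sqsubseteq> u"
      using greatest_mem[OF g] by (auto simp: Upper_def Lower_def)
  qed (use xy greatest_closed[OF g] in auto)
  then show "\<exists>s. least L s ?U" ..
qed

section \<open>Membership and order in the m-cover poset\<close>

text \<open>In a weak partial order, least elements are unique only up to \<open>.=\<close>. Joining
  \<open>partial_order\<close> turns this into equality, so that removing \<open>\<bottom>\<close>
  removes every least element.\<close>

locale partial_order_bottom = partial_order + weak_partial_order_bottom

text \<open>Three non-bottom entries in a chain \<open>u \<sqsubset> v \<sqsubset> w\<close> would
  make \<open>w\<close> a cover of \<open>u\<close> with \<open>v\<close> in between, so requiring
  covers pair by pair already limits the number of entries. This form can be checked entry by entry,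
  which suits componentwise meets.\<close>

lemma (in partial_order_bottom) mem_m_cover_poset_iff:
  "xs \<in> carrier (m_cover_poset m L) \<longleftrightarrow>
    length xs = m \<and> set xs \<subseteq> carrier L \<and> sorted_wrt (\<sqsubseteq>) xs \<and>
    (\<forall>u\<in>set xs. \<forall>v\<in>set xs. u \<noteq> \<bottom> \<longrightarrow> u \<sqsubset> v \<longrightarrow> covered_by L u v)"
proof -
  let ?S = "set xs - {\<bottom>}"
  have "(?S = {} \<or> (\<exists>p. ?S = {p}) \<or> (\<exists>p q. ?S = {p, q} \<and> covered_by L p q)) \<longleftrightarrow>
      (\<forall>u\<in>set xs. \<forall>v\<in>set xs. u \<noteq> \<bottom> \<longrightarrow> u \<sqsubset> v \<longrightarrow> covered_by L u v)" (is "?A \<longleftrightarrow> ?B")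
    if carr: "set xs \<subseteq> carrier L" and sorted: "sorted_wrt (\<sqsubseteq>) xs"
  proof
    assume A: ?A
    show ?B
    proof (intro ballI impI)
      fix u v assume uv: "u \<in> set xs" "v \<in> set xs" "u \<noteq> \<bottom>" "u \<sqsubset> v"
      have "v \<noteq> \<bottom>"
        using uv carr le_antisym[of u \<bottom>] by (auto simp: lless_eq)
      then have "u \<in> ?S" "v \<in> ?S" "u \<noteq> v"
        using uv by (auto simp: lless_eq)
      then obtain p q where "?S = {p, q}" "covered_by L p q"
        using A by (metis empty_iff singletonD)
      with \<open>u \<in> ?S\<close> \<open>v \<in> ?S\<close> \<open>u \<noteq> v\<close> uv(4) show "covered_by L u v"
        using lless_antisym[of p q] by (auto simp: covered_by_def)
    qed
  next
    assume B: ?B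
    have total: "u \<sqsubset> v \<or> v \<sqsubset> u" if "u \<in> set xs" "v \<in> set xs" "u \<noteq> v" for u v
      using that sorted
      by (auto simp: sorted_wrt_iff_nth_less in_set_conv_nth lless_eq) (metis nat_neq_iff)
    show ?A
    proof (rule ccontr)
      assume nA: "\<not> ?A"
      then obtain p where p: "p \<in> ?S" by blast
      then obtain q where q: "q \<in> ?S" "q \<noteq> p"
        using nA by blast
      obtain a b where ab: "a \<in> ?S" "b \<in> ?S" "a \<sqsubset> b"
        using total[of p q] p q by blast
      then have cov: "covered_by L a b"
        using B by blast
      then obtain r where r: "r \<in> ?S" "r \<noteq> a" "r \<noteq> b"
        using nA ab by blast
      have chain3: False
        if "u \<in> ?S" "v \<in> ?S" "w \<in> ?S" "u \<sqsubset> v" "v \<sqsubset> w" for u v w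
      proof -
        have "u \<sqsubset> w"
          using that carr lless_trans[of u v w] by blast
        then have "covered_by L u w"
          using that B by blast
        then show False
          using that carr by (auto simp: covered_by_def)
      qed
      \<comment> \<open>As \<open>r\<close> is comparable with \<open>a\<close> and with
        \<open>b\<close>, it lies below \<open>a\<close>, between the two, or above
        \<open>b\<close>. Each position gives a chain of three.\<close>
      show False
        using total[of r a] total[of r b] r ab chain3 by blast
    qed
  qed
  then show ?thesis
    by (auto simp: m_cover_poset_def power_poset_def)
qed

lemma le_m_cover_poset [simp]: "le (m_cover_poset m L) = list_all2 (le L)"
  and eq_m_cover_poset [simp]: "eq (m_cover_poset m L) = (=)"
  by (simp_all add: m_cover_poset_def power_poset_def)

lemma (in partial_order) partial_order_m_cover_poset: "partial_order (m_cover_poset m L)"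
proof -
  have carr: "length xs = m" "set xs \<subseteq> carrier L"
    if "xs \<in> carrier (m_cover_poset m L)" for xs
    using that by (auto simp: m_cover_poset_def power_poset_def)
  have nth: "xs ! i \<in> carrier L" if "xs \<in> carrier (m_cover_poset m L)" "i < m" for xs i
    using carr[OF that(1)] that(2) by (auto simp: subset_iff)
  show ?thesis
  proof unfold_locales
    fix xs assume "xs \<in> carrier (m_cover_poset m L)"
    then show "xs \<sqsubseteq>\<^bsub>m_cover_poset m L\<^esub> xs"
      using carr nth by (auto simp: list_all2_conv_all_nth)
  next
    fix xs ys assume "xs \<sqsubseteq>\<^bsub>m_cover_poset m L\<^esub> ys" "ys \<sqsubseteq>\<^bsub>m_cover_poset m L\<^esub> xs"
      "xs \<in> carrier (m_cover_poset m L)" "ys \<in> carrier (m_cover_poset m L)"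
    then show "xs .=\<^bsub>m_cover_poset m L\<^esub> ys"
      using carr nth by (auto simp: list_all2_conv_all_nth intro!: nth_equalityI)
  next
    fix xs ys zs assume "xs \<sqsubseteq>\<^bsub>m_cover_poset m L\<^esub> ys" "ys \<sqsubseteq>\<^bsub>m_cover_poset m L\<^esub> zs"
      "xs \<in> carrier (m_cover_poset m L)" "ys \<in> carrier (m_cover_poset m L)"
      "zs \<in> carrier (m_cover_poset m L)"
    then show "xs \<sqsubseteq>\<^bsub>m_cover_poset m L\<^esub> zs"
      using carr nth by (auto simp: list_all2_conv_all_nth intro: le_trans)
  qed auto
qed

lemma finite_carrier_m_cover_poset:
  assumes "finite (carrier L)"
  shows "finite (carrier (m_cover_poset m L))"
proof -
  have "carrier (m_cover_poset m L) \<subseteq> {xs. set xs \<subseteq> carrier L \<and> length xs = m}"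
    by (auto simp: m_cover_poset_def power_poset_def)
  then show ?thesis
    using finite_lists_length_eq[OF assms] finite_subset by blast
qed

lemma (in partial_order_bottom) replicate_mem_m_cover_poset:
  assumes "x \<in> carrier L"
  shows "replicate m x \<in> carrier (m_cover_poset m L)"
  using assms by (auto simp: mem_m_cover_poset_iff sorted_wrt_iff_nth_less lless_eq)

lemma (in partial_order_bottom) pair_mem_m_cover_poset:
  assumes "covered_by L x y"
  shows "[x, y] \<in> carrier (m_cover_poset 2 L)"
  using assms lless_antisym[of x y] unfolding mem_m_cover_poset_iff
  by (auto simp: covered_by_def lless_eq)

section \<open>Sufficiency: componentwise meets\<close>

text \<open>A non-bottom meet at position \<open>i\<close> is one of the two entries there, say
  \<open>xs ! i\<close>. A strictly larger meet at \<open>j\<close> is also below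
  \<open>xs ! j\<close>, and since \<open>xs ! j\<close> then covers \<open>xs ! i\<close>, it can
  only be \<open>xs ! j\<close> itself.\<close>

lemma (in lattice) map2_meet_mem_m_cover_poset:
  assumes "weak_partial_order_bottom L"
    and meet: "\<And>p q. p \<in> carrier L \<Longrightarrow> q \<in> carrier L \<Longrightarrow> p \<sqinter> q \<in> {\<bottom>, p, q}"
    and xs: "xs \<in> carrier (m_cover_poset m L)"
    and ys: "ys \<in> carrier (m_cover_poset m L)"
  shows "map2 (\<sqinter>) xs ys \<in> carrier (m_cover_poset m L)"
proof -
  interpret weak_partial_order_bottom L by (rule assms(1))
  interpret partial_order_bottom L ..
  note xs' = xs[unfolded mem_m_cover_poset_iff]
  note ys' = ys[unfolded mem_m_cover_poset_iff]
  have len: "length xs = m" "length ys = m"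
    using xs' ys' by auto
  have nth: "xs ! i \<in> carrier L" "ys ! i \<in> carrier L" if "i < m" for i
    using xs' ys' that by (auto simp: subset_iff)
  have mono: "xs ! i \<sqsubseteq> xs ! j" "ys ! i \<sqsubseteq> ys ! j" if "i < j" "j < m" for i j
    using xs' ys' that by (auto simp: sorted_wrt_iff_nth_less)
  have meet_mono: "xs ! i \<sqinter> ys ! i \<sqsubseteq> xs ! j \<sqinter> ys ! j" if "i < j" "j < m" for i j
  proof (rule meet_le)
    show "xs ! i \<sqinter> ys ! i \<sqsubseteq> xs ! j"
      using that nth[of i] nth[of j] mono[of i j] meet_left meet_closed le_trans
      by (meson less_trans)
    show "xs ! i \<sqinter> ys ! i \<sqsubseteq> ys ! j"
      using that nth[of i] nth[of j] mono[of i j] meet_right meet_closed le_trans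
      by (meson less_trans)
  qed (use that nth in auto)
  \<comment> \<open>To be used with \<open>xs\<close> or \<open>ys\<close> for \<open>zs\<close> and
    with the meet at \<open>j\<close> for \<open>v\<close>.\<close>
  have cov_aux: "covered_by L (zs ! i) v"
    if zs: "zs \<in> carrier (m_cover_poset m L)" and ij: "i < m" "j < m"
      and v: "v \<in> carrier L" "zs ! i \<noteq> \<bottom>" "zs ! i \<sqsubset> v" "v \<sqsubseteq> zs ! j" for zs i j v
  proof -
    note zs' = zs[unfolded mem_m_cover_poset_iff]
    have c: "zs ! i \<in> carrier L" "zs ! j \<in> carrier L"
      using zs' ij by (auto simp: subset_iff)
    then have "zs ! i \<sqsubset> zs ! j"
      using v le_trans[of "zs ! i" v "zs ! j"] by (auto simp: lless_eq)
    then have "covered_by L (zs ! i) (zs ! j)"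
      using zs' ij v(2) by auto
    moreover from this have "v = zs ! j"
      using v by (auto simp: covered_by_def lless_eq)
    ultimately show ?thesis by simp
  qed
  have "covered_by L (xs ! i \<sqinter> ys ! i) (xs ! j \<sqinter> ys ! j)"
    if ij: "i < m" "j < m" and *: "xs ! i \<sqinter> ys ! i \<noteq> \<bottom>"
      "xs ! i \<sqinter> ys ! i \<sqsubset> xs ! j \<sqinter> ys ! j" for i j
  proof -
    consider "xs ! i \<sqinter> ys ! i = xs ! i" | "xs ! i \<sqinter> ys ! i = ys ! i"
      using meet[of "xs ! i" "ys ! i"] nth[OF ij(1)] * by auto
    then show ?thesis
      using cov_aux[OF xs ij] cov_aux[OF ys ij] nth[OF ij(2)] *
        meet_left[of "xs ! j" "ys ! j"] meet_right[of "xs ! j" "ys ! j"]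
      by cases auto
  qed
  then show ?thesis
    unfolding mem_m_cover_poset_iff
    using len nth meet_mono
    by (auto simp: sorted_wrt_iff_nth_less in_set_conv_nth set_zip)
qed

text \<open>Only meets are computed componentwise: a componentwise join of two members may fail to
  be a member. Joins come instead from finiteness and the constant tuple of
  \<open>\<top>\<close>.\<close>

lemma (in lattice) lattice_m_cover_poset:
  assumes "finite (carrier L)" "weak_partial_order_bottom L" "weak_partial_order_top L"
    and meet: "\<And>p q. p \<in> carrier L \<Longrightarrow> q \<in> carrier L \<Longrightarrow> p \<sqinter> q \<in> {\<bottom>, p, q}"
  shows "lattice (m_cover_poset m L)"
proof -
  interpret weak_partial_order_bottom L by (rule assms(2))
  interpret weak_partial_order_top L by (rule assms(3))
  interpret partial_order_bottom L ..
  let ?M = "m_cover_poset m L"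
  have carr: "length xs = m" "set xs \<subseteq> carrier L" if "xs \<in> carrier ?M" for xs
    using that by (auto simp: mem_m_cover_poset_iff)
  have nth: "xs ! i \<in> carrier L" if "xs \<in> carrier ?M" "i < m" for xs i
    using carr[OF that(1)] that(2) by (auto simp: subset_iff)
  interpret M: partial_order ?M
    by (rule partial_order_m_cover_poset)
  interpret M: lower_semilattice ?M
  proof unfold_locales
    fix xs ys assume xy: "xs \<in> carrier ?M" "ys \<in> carrier ?M"
    have "greatest ?M (map2 (\<sqinter>) xs ys) (Lower ?M {xs, ys})"
    proof (rule greatest_LowerI)
      fix zs assume "zs \<in> {xs, ys}"
      then show "map2 (\<sqinter>) xs ys \<sqsubseteq>\<^bsub>?M\<^esub> zs"
        using xy carr nth by (auto simp: list_all2_conv_all_nth intro: meet_left meet_right)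
    next
      fix zs assume "zs \<in> Lower ?M {xs, ys}"
      then show "zs \<sqsubseteq>\<^bsub>?M\<^esub> map2 (\<sqinter>) xs ys"
        using xy carr nth by (auto simp: Lower_def list_all2_conv_all_nth intro!: meet_le)
    next
      show "map2 (\<sqinter>) xs ys \<in> carrier ?M"
        using map2_meet_mem_m_cover_poset[OF assms(2) meet xy] by blast
    qed (use xy in auto)
    then show "\<exists>s. greatest ?M s (Lower ?M {xs, ys})" ..
  qed
  show ?thesis
  proof (rule M.finite_lattice_if_top)
    show "finite (carrier ?M)"
      by (rule finite_carrier_m_cover_poset[OF assms(1)])
    show "replicate m \<top> \<in> carrier ?M"
      by (rule replicate_mem_m_cover_poset) simp
    show "xs \<sqsubseteq>\<^bsub>?M\<^esub> replicate m \<top>" if "xs \<in> carrier ?M" for xs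
      using carr nth that by (auto simp: list_all2_conv_all_nth)
  qed
qed

section \<open>Necessity: tuples of length one and two\<close>

text \<open>The cover condition is void for a single entry, so \<open>x \<mapsto> [x]\<close> is an
  order isomorphism, along which joins and meets are carried back.\<close>

lemma (in partial_order_bottom) lattice_if_lattice_1_cover_poset:
  assumes "lattice (m_cover_poset 1 L)"
  shows "lattice L"
proof -
  let ?M = "m_cover_poset 1 L"
  interpret M: lattice ?M by (rule assms)
  have mem: "xs \<in> carrier ?M \<longleftrightarrow> (\<exists>x \<in> carrier L. xs = [x])" for xs
    by (auto simp: mem_m_cover_poset_iff length_Suc_conv lless_eq)
  show ?thesis
  proof unfold_locales
    fix x y assume xy: "x \<in> carrier L" "y \<in> carrier L"
    obtain s where s: "least ?M s (Upper ?M {[x], [y]})"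
      using M.sup_of_two_exists[of "[x]" "[y]"] xy mem by blast
    then obtain t where "s = [t]" "t \<in> carrier L"
      using least_closed[OF s] mem by auto
    with s xy have "least L t (Upper L {x, y})"
      by (auto simp: least_def Upper_def mem simp del: One_nat_def)
    then show "\<exists>s. least L s (Upper L {x, y})" ..
    obtain s where s: "greatest ?M s (Lower ?M {[x], [y]})"
      using M.inf_of_two_exists[of "[x]" "[y]"] xy mem by blast
    then obtain t where "s = [t]" "t \<in> carrier L"
      using greatest_closed[OF s] mem by auto
    with s xy have "greatest L t (Lower L {x, y})"
      by (auto simp: greatest_def Lower_def mem simp del: One_nat_def)
    then show "\<exists>s. greatest L s (Lower L {x, y})" ..
  qed
qed

lemma (in lattice) no_common_lower_cover_if_lattice_2_cover_poset:
  assumes "finite (carrier L)" "weak_partial_order_bottom L"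
    and "lattice (m_cover_poset 2 L)"
    and "z \<noteq> \<bottom>" and zp: "covered_by L z p" and zq: "covered_by L z q"
  shows "p = q"
proof (rule ccontr)
  assume "p \<noteq> q"
  interpret weak_partial_order_bottom L by (rule assms(2))
  interpret partial_order_bottom L ..
  let ?M = "m_cover_poset 2 L"
  interpret M: lattice ?M by (rule assms(3))
  define r where "r = p \<squnion> q"
  have c: "z \<in> carrier L" "p \<in> carrier L" "q \<in> carrier L" "z \<sqsubset> p" "z \<sqsubset> q"
    using zp zq by (auto simp: covered_by_def)
  then have r: "r \<in> carrier L" "p \<sqsubseteq> r" "q \<sqsubseteq> r"
    by (auto simp: r_def join_left join_right)
  \<comment> \<open>Otherwise one of \<open>p\<close> and \<open>q\<close> would lie strictly
    between \<open>z\<close> and the other, which covers \<open>z\<close>.\<close>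
  have "p \<noteq> r" "q \<noteq> r"
    using r c zp zq \<open>p \<noteq> q\<close> by (auto simp: covered_by_def lless_eq)
  then have "p \<sqsubset> r" "q \<sqsubset> r"
    using r by (auto simp: lless_eq)
  obtain a where a: "covered_by L a r" "p \<sqsubseteq> a"
    using exists_lower_cover[OF assms(1) c(2) r(1) \<open>p \<sqsubset> r\<close>] by blast
  obtain b where b: "covered_by L b r" "q \<sqsubseteq> b"
    using exists_lower_cover[OF assms(1) c(3) r(1) \<open>q \<sqsubset> r\<close>] by blast
  have ab: "a \<in> carrier L" "b \<in> carrier L" "a \<sqsubset> r" "b \<sqsubset> r"
    using a b by (auto simp: covered_by_def)
  have zab: "z \<sqsubseteq> a" "z \<sqsubseteq> b"
    using c a b ab le_trans[of z p a] le_trans[of z q b] by (auto simp: lless_eq)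
  have pairs: "[z, p] \<in> carrier ?M" "[z, q] \<in> carrier ?M"
    "[a, r] \<in> carrier ?M" "[b, r] \<in> carrier ?M"
    using zp zq a b by (auto intro: pair_mem_m_cover_poset)
  obtain s where s: "least ?M s (Upper ?M {[z, p], [z, q]})"
    using M.sup_of_two_exists pairs by blast
  have sM: "s \<in> carrier ?M"
    using s by auto
  then have "length s = 2"
    by (simp add: mem_m_cover_poset_iff)
  then obtain u v where uv: "s = [u, v]"
    by (auto simp: length_Suc_conv numeral_2_eq_2)
  have c': "u \<in> carrier L" "v \<in> carrier L"
    and cov: "u \<noteq> \<bottom> \<Longrightarrow> u \<sqsubset> v \<Longrightarrow> covered_by L u v"
    using sM by (auto simp: uv mem_m_cover_poset_iff)
  \<comment> \<open>These two upper bounds force the second entry of the join to be \<open>r\<close>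
    and its first entry to lie below both \<open>a\<close> and \<open>b\<close>.\<close>
  have "[a, r] \<in> Upper ?M {[z, p], [z, q]}" "[b, r] \<in> Upper ?M {[z, p], [z, q]}"
    using pairs zab r by (auto simp: Upper_def)
  then have below: "u \<sqsubseteq> a" "u \<sqsubseteq> b" "v \<sqsubseteq> r"
    using least_le[OF s, of "[a, r]"] least_le[OF s, of "[b, r]"] by (auto simp: uv)
  have above: "z \<sqsubseteq> u" "p \<sqsubseteq> v" "q \<sqsubseteq> v"
    using least_mem[OF s] pairs by (auto simp: uv Upper_def)
  have "v = r"
    using above below c c' r join_le[of p v q] by (auto simp: r_def)
  \<comment> \<open>Here \<open>z \<noteq> \<bottom>\<close> is essential: a first entry
    \<open>\<bottom>\<close> would put no cover condition on the pair.\<close>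
  have "u \<noteq> \<bottom>"
    using \<open>z \<noteq> \<bottom>\<close> above c c' le_antisym[of z \<bottom>] by auto
  moreover have "u \<sqsubset> v"
    using \<open>v = r\<close> below ab c' r le_antisym[of a r] le_trans[of u a r] by (auto simp: lless_eq)
  ultimately have "covered_by L u r"
    using cov \<open>v = r\<close> by blast
  \<comment> \<open>Both \<open>a\<close> and \<open>b\<close> lie between \<open>u\<close> and its
    cover \<open>r\<close> and differ from \<open>r\<close>. Hence they coincide, and
    \<open>a\<close> is above both \<open>p\<close> and \<open>q\<close>, hence above their join
    \<open>r\<close>.\<close>
  then have "u = a" "u = b"
    using below ab by (auto simp: covered_by_def lless_eq)
  then have "r \<sqsubseteq> a"
    using a b ab c join_le[of p a q] by (auto simp: r_def)
  then show False
    using ab r le_antisym[of a r] by (auto simp: lless_eq)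
qed

text \<open>If the meet differs from \<open>\<bottom>\<close>, \<open>p\<close> and
  \<open>q\<close>, it has a cover below \<open>p\<close> and a cover below \<open>q\<close>. These
  coincide by \<open>cover\<close>, giving a common lower bound strictly above the meet.\<close>

lemma (in lattice) meet_trivial_if_no_common_lower_cover:
  assumes fin: "finite (carrier L)"
    and cover: "\<And>z p q. z \<noteq> \<bottom> \<Longrightarrow> covered_by L z p \<Longrightarrow> covered_by L z q \<Longrightarrow> p = q"
    and pq: "p \<in> carrier L" "q \<in> carrier L"
  shows "p \<sqinter> q \<in> {\<bottom>, p, q}"
proof (rule ccontr)
  let ?z = "p \<sqinter> q"
  assume *: "?z \<notin> {\<bottom>, p, q}"
  have z: "?z \<in> carrier L" "?z \<sqsubset> p" "?z \<sqsubset> q"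
    using * pq by (auto simp: lless_eq meet_left meet_right)
  obtain p' where p': "covered_by L ?z p'" "p' \<sqsubseteq> p"
    using exists_upper_cover[OF fin z(1) pq(1) z(2)] by blast
  obtain q' where q': "covered_by L ?z q'" "q' \<sqsubseteq> q"
    using exists_upper_cover[OF fin z(1) pq(2) z(3)] by blast
  have "p' = q'"
    using cover[of ?z p' q'] p' q' * by blast
  then have "p' \<sqsubseteq> ?z"
    using p' q' pq by (auto simp: covered_by_def intro: meet_le)
  then show False
    using p' by (auto simp: covered_by_def lless_eq)
qed

theorem theorem2p4:
  fixes P :: "('a, 'b) gorder_scheme" (structure)
  assumes "partial_order P"
    and "finite (carrier P)"
    and "weak_partial_order_bottom P"
    and "weak_partial_order_top P"
  shows "(\<forall>m::nat. m > 0 \<longrightarrow> lattice (m_cover_poset m P)) \<longleftrightarrow>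
    (lattice P \<and> (\<forall>p \<in> carrier P. \<forall>q \<in> carrier P. p \<sqinter>\<^bsub>P\<^esub> q \<in> {\<bottom>\<^bsub>P\<^esub>, p, q}))"
proof
  assume cover_lattice: "\<forall>m::nat. m > 0 \<longrightarrow> lattice (m_cover_poset m P)"
  interpret partial_order_bottom P
    using assms(1,3) by (rule partial_order_bottom.intro)
  \<comment> \<open>This direction draws only on the cases \<open>m = 1\<close>, for the lattice
    property, and \<open>m = 2\<close>, for the condition on meets.\<close>
  have "lattice P"
    using cover_lattice by (intro lattice_if_lattice_1_cover_poset) simp
  then interpret lattice P .
  have "lattice (m_cover_poset 2 P)"
    using cover_lattice by simp
  then show "lattice P \<and> (\<forall>p \<in> carrier P. \<forall>q \<in> carrier P. p \<sqinter>\<^bsub>P\<^esub> q \<in> {\<bottom>\<^bsub>P\<^esub>, p, q})"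
    using \<open>lattice P\<close> meet_trivial_if_no_common_lower_cover[OF assms(2)]
      no_common_lower_cover_if_lattice_2_cover_poset[OF assms(2,3)] by blast
next
  assume "lattice P \<and> (\<forall>p \<in> carrier P. \<forall>q \<in> carrier P. p \<sqinter>\<^bsub>P\<^esub> q \<in> {\<bottom>\<^bsub>P\<^esub>, p, q})"
  then show "\<forall>m::nat. m > 0 \<longrightarrow> lattice (m_cover_poset m P)"
    using lattice.lattice_m_cover_poset[OF _ assms(2,3,4)] by blast
qed

end
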